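(* Let $D\subseteq V_1$, let $c\in\mathbb{Z}_+$, and let $C_1^k\subseteq V_1$ and $C_2^k\subseteq V_2$ for $k=1,\dots,c$ be such that - $|C_1^k|\ge2$ for each $k=1,\dots,c$; - for each $k=1,\dots,c$ there is $n_\omega(C_1^k)\in\mathbb{Z}_+$ such that every pair of distinct nodes $\{i,j\}\subseteq C_1^k$ satisfies $|\mathcal{U}_\omega(\{i,j\},V_1\setminus C_1^k)\cap C_2^k|=n_\omega(C_1^k)$; - $C_2^i\cap C_2^j=\emptyset$ for all $i,j\in\{1,\dots,c\}$ with $i\ne j$. Then the inequality $$\theta_\omega\le\sum_{k=1}^{c}n_\omega(C_1^k)\Big(1-\sum_{j\in C_1^k}x_j\Big)+\sum_{k\in D}\eta_\omega^k(1-x_k)+\sum_{j\in V_1}\sigma_\omega(\{j\})x_j$$ is valid for $\mathcal{S}_\omega$, i.e., it is satisfied by every $(\theta_\omega,x)\in\mathcal{S}_\omega$.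
   Context: Fix a bipartite directed graph (live-arc graph of scenario $\omega$) $G_\omega=(V_1\cup V_2,E_\omega)$ with $V_1=\{1,\dots,n\}$, $V_2=\{1,\dots,m\}$ and all arcs $(i,j)\in E_\omega$ going from $i\in V_1$ to $j\in V_2$. For $S\subseteq V_1$, $\sigma_\omega(S)$ is the number of nodes $j\in V_2$ such that $(i,j)\in E_\omega$ for some $i\in S$, and for $j\in V_1\setminus S$, $\rho_j^\omega(S)=\sigma_\omega(S\cup\{j\})-\sigma_\omega(S)$. Define $$\mathcal{S}_\omega=\Big\{(\theta_\omega,x)\in\mathbb{R}\times\{0,1\}^n:\ \theta_\omega\le\sigma_\omega(S)+\sum_{j\in V_1\setminus S}\rho_j^\omega(S)x_j\ \ \forall S\subseteq V_1\Big\}.$$ For disjoint $B,N\subseteq V_1$, $\mathcal{U}_\omega(B,N)=\{j\in V_2:(i,j)\in E_\omega\ \forall i\in B;\ (i,j)\notin E_\omega\ \forall i\in N\}$. For $k\in V_1$, $\eta_\omega^k=|\mathcal{U}_\omega(\{k\},V_1\setminus\{k\})|$. *)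

theory Defs
  imports Complex_Main "HOL-Library.FuncSet"
begin

(* V1 n and V2 m are the two sides of the bipartite graph. Their labels overlap as natural
   numbers, but the first component of an arc always refers to the left side and the second
   component to the right side. *)

definition V1 :: "nat \<Rightarrow> nat set" where
  "V1 n = {1..n}"

definition V2 :: "nat \<Rightarrow> nat set" where
  "V2 m = {1..m}"

definition bipartite_arcs :: "nat \<Rightarrow> nat \<Rightarrow> (nat \<times> nat) set \<Rightarrow> bool" where
  "bipartite_arcs n m E \<longleftrightarrow> E \<subseteq> V1 n \<times> V2 m"

definition cover :: "nat \<Rightarrow> (nat \<times> nat) set \<Rightarrow> nat set \<Rightarrow> nat" where
  "cover m E S = card {j \<in> V2 m. \<exists>i\<in>S. (i, j) \<in> E}"

definition marginal :: "nat \<Rightarrow> (nat \<times> nat) set \<Rightarrow> nat \<Rightarrow> nat set \<Rightarrow> real" where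
  "marginal m E j S = real (cover m E (S \<union> {j})) - real (cover m E S)"

(* A vector in {0,1}^n is a function on {1..n} that is undefined elsewhere. *)
definition feasible_set ::
  "nat \<Rightarrow> nat \<Rightarrow> (nat \<times> nat) set \<Rightarrow> (real \<times> (nat \<Rightarrow> real)) set" where
  "feasible_set n m E =
     {(\<theta>, x). x \<in> V1 n \<rightarrow>\<^sub>E {0, 1} \<and>
        (\<forall>S. S \<subseteq> V1 n \<longrightarrow>
           \<theta> \<le> real (cover m E S) + (\<Sum>j \<in> V1 n - S. marginal m E j S * x j))}"

(* Meant for disjoint B and N. *)
definition exclusive_common :: "nat \<Rightarrow> (nat \<times> nat) set \<Rightarrow> nat set \<Rightarrow> nat set \<Rightarrow> nat set" where
  "exclusive_common m E B N =
     {j \<in> V2 m. (\<forall>i\<in>B. (i, j) \<in> E) \<and> (\<forall>i\<in>N. (i, j) \<notin> E)}"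

definition private_count :: "nat \<Rightarrow> nat \<Rightarrow> (nat \<times> nat) set \<Rightarrow> nat \<Rightarrow> nat" where
  "private_count n m E k = card (exclusive_common m E {k} (V1 n - {k}))"

end

theory Submission
  imports Defs
begin

text \<open>
  A binary vector x is the indicator of the set S of its nonzero coordinates, and the inequality of
  the feasible set for this particular S reads \<theta> \<le> \<sigma>(S), because the marginal terms range over
  coordinates where x vanishes. It therefore suffices to bound \<sigma>(S) for every S.

  In the sum of \<sigma>({i}) over S, a node v with d > 0 neighbours in S is counted d times, but only once
  in \<sigma>(S). Its excess d - 1 measures the overcounting, and the sum of the \<sigma>({i}) equals \<sigma>(S) plus
  the total excess (lemma \<open>sum_cover_singletons\<close>). So it is enough that the terms
  n(C1) (|S \<inter> C1| - 1) take back no more than this excess. For a single k this holds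
  already on the nodes of C2 (lemma \<open>clique_excess\<close>): fix a node a in S \<inter> C1; each of the
  other |S \<inter> C1| - 1 nodes of S \<inter> C1 shares n(C1) nodes of C2 with a, and a node v of C2 is
  shared in this way at most as often as its excess, since a itself is one of its neighbours. The
  sets C2 are disjoint, so no excess is charged twice, and the terms indexed by D are nonnegative.
\<close>

text \<open>Truncated subtraction makes the excess of an uncovered node 0, as it should be.\<close>
definition excess :: "(nat \<times> nat) set \<Rightarrow> nat set \<Rightarrow> nat \<Rightarrow> nat" where
  "excess E S v = card {i \<in> S. (i, v) \<in> E} - 1"

lemma sum_card_swap:
  assumes "finite A" "finite B"
  shows "(\<Sum>i\<in>A. card {v \<in> B. R i v}) = (\<Sum>v\<in>B. card {i \<in> A. R i v})"
proof -
  have "(\<Sum>i\<in>A. card {v \<in> B. R i v}) = (\<Sum>i\<in>A. \<Sum>v\<in>B. if R i v then 1 else 0)"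
    using assms by (simp only: card_eq_sum sum.inter_filter)
  also have "\<dots> = (\<Sum>v\<in>B. \<Sum>i\<in>A. if R i v then 1 else 0)"
    by (rule sum.swap)
  also have "\<dots> = (\<Sum>v\<in>B. card {i \<in> A. R i v})"
    using assms by (simp only: card_eq_sum sum.inter_filter)
  finally show ?thesis .
qed

lemma sum_cover_singletons:
  assumes S: "finite S"
  shows "(\<Sum>i\<in>S. cover m E {i}) = cover m E S + (\<Sum>v\<in>V2 m. excess E S v)"
proof -
  have fin: "finite (V2 m)" by (simp add: V2_def)
  have split: "card {i \<in> S. (i, v) \<in> E} = (if \<exists>i\<in>S. (i, v) \<in> E then 1 else 0) + excess E S v"
    for v
  proof (cases "\<exists>i\<in>S. (i, v) \<in> E")
    case True
    then have "card {i \<in> S. (i, v) \<in> E} > 0"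
      using S by (auto simp: card_gt_0_iff)
    with True show ?thesis by (simp add: excess_def)
  next
    case False
    then have empty: "{i \<in> S. (i, v) \<in> E} = {}" by blast
    show ?thesis unfolding excess_def empty using False by simp
  qed
  have "(\<Sum>i\<in>S. cover m E {i}) = (\<Sum>v\<in>V2 m. card {i \<in> S. (i, v) \<in> E})"
    unfolding cover_def using sum_card_swap[OF S fin, of "\<lambda>i v. (i, v) \<in> E"] by simp
  also have "\<dots> = (\<Sum>v\<in>V2 m. if \<exists>i\<in>S. (i, v) \<in> E then 1 else 0) + (\<Sum>v\<in>V2 m. excess E S v)"
    by (simp only: split sum.distrib)
  also have "(\<Sum>v\<in>V2 m. if \<exists>i\<in>S. (i, v) \<in> E then 1 else 0) = cover m E S"
    unfolding cover_def using fin by (simp only: card_eq_sum sum.inter_filter)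
  finally show ?thesis .
qed

text \<open>
  Comparing every node of S \<inter> C with one fixed node a of that set is what makes the bound linear
  in |S \<inter> C|. If S \<inter> C is empty, there is no such node, but then the left-hand side is -q.
\<close>
lemma clique_excess:
  assumes S: "finite S" and F: "finite F"
    and pairs: "\<And>i j. i \<in> C \<Longrightarrow> j \<in> C \<Longrightarrow> i \<noteq> j \<Longrightarrow>
      card (exclusive_common m E {i, j} N \<inter> F) = q"
  shows "real q * (real (card (S \<inter> C)) - 1) \<le> real (\<Sum>v\<in>F. excess E S v)"
proof (cases "S \<inter> C = {}")
  case True
  have "0 \<le> real (\<Sum>v\<in>F. excess E S v)" by (rule of_nat_0_le_iff)
  with True show ?thesis by simp
next
  case False
  then obtain a where a: "a \<in> S" "a \<in> C" by blast
  define T where "T = S \<inter> C - {a}"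
  have T: "finite T" "T \<subseteq> S" "a \<notin> T" using S by (auto simp: T_def)
  have "card (S \<inter> C) = Suc (card T)"
    unfolding T_def using S a by (intro card.remove) auto
  then have card_T: "real (card (S \<inter> C)) - 1 = real (card T)" by simp
  let ?R = "\<lambda>i v. v \<in> exclusive_common m E {a, i} N"
  have "card {v \<in> F. ?R i v} = q" if "i \<in> T" for i
  proof -
    have "{v \<in> F. ?R i v} = exclusive_common m E {a, i} N \<inter> F" by blast
    with that a pairs[of a i] show ?thesis by (auto simp: T_def)
  qed
  then have "q * card T = (\<Sum>i\<in>T. card {v \<in> F. ?R i v})" by simp
  also have "\<dots> = (\<Sum>v\<in>F. card {i \<in> T. ?R i v})"
    using T(1) F by (rule sum_card_swap)
  also have "\<dots> \<le> (\<Sum>v\<in>F. excess E S v)"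
  proof (rule sum_mono)
    fix v
    show "card {i \<in> T. ?R i v} \<le> excess E S v"
    proof (cases "{i \<in> T. ?R i v} = {}")
      case True
      then show ?thesis by (simp only: card.empty le0)
    next
      case False
      then have "insert a {i \<in> T. ?R i v} \<subseteq> {i \<in> S. (i, v) \<in> E}"
        using a T(2) by (auto simp: exclusive_common_def)
      then have "card (insert a {i \<in> T. ?R i v}) \<le> card {i \<in> S. (i, v) \<in> E}"
        using S by (intro card_mono) auto
      moreover have "card (insert a {i \<in> T. ?R i v}) = Suc (card {i \<in> T. ?R i v})"
        using T by (intro card_insert_disjoint) auto
      ultimately show ?thesis by (simp add: excess_def)
    qed
  qed
  finally have "q * card T \<le> (\<Sum>v\<in>F. excess E S v)" .
  then show ?thesis
    by (simp only: card_T of_nat_mult[symmetric] of_nat_le_iff)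
qed

lemma sum_binary:
  fixes x :: "'a \<Rightarrow> real"
  assumes "finite A" "\<And>i. i \<in> A \<Longrightarrow> x i \<in> {0, 1}"
  shows "(\<Sum>i\<in>A. f i * x i) = (\<Sum>i\<in>{i \<in> A. x i = 1}. f i)"
proof -
  have "(\<Sum>i\<in>A. f i * x i) = (\<Sum>i\<in>A. if x i = 1 then f i else 0)"
    using assms(2) by (intro sum.cong) auto
  then show ?thesis
    using assms(1) by (simp only: sum.inter_filter)
qed

lemma feasible_le_cover_support:
  assumes "(\<theta>, x) \<in> feasible_set n m E"
  shows "\<theta> \<le> real (cover m E {i \<in> V1 n. x i = 1})"
proof -
  let ?S = "{i \<in> V1 n. x i = 1}"
  have x: "x \<in> V1 n \<rightarrow>\<^sub>E {0, 1}"
    and "\<theta> \<le> real (cover m E ?S) + (\<Sum>j \<in> V1 n - ?S. marginal m E j ?S * x j)"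
    using assms by (simp_all add: feasible_set_def)
  moreover have "(\<Sum>j \<in> V1 n - ?S. marginal m E j ?S * x j) = 0"
    using x by (intro sum.neutral ballI) (force simp: PiE_def Pi_def)
  ultimately show ?thesis by simp
qed

theorem proposition3p4:
  fixes n m c :: nat
    and E :: "(nat \<times> nat) set"
    and D :: "nat set"
    and C1 C2 :: "nat \<Rightarrow> nat set"
    and nC :: "nat \<Rightarrow> nat"
  assumes graph: "bipartite_arcs n m E"
    and D: "D \<subseteq> V1 n"
    and C1: "\<forall>k\<in>{1..c}. C1 k \<subseteq> V1 n"
    and C2: "\<forall>k\<in>{1..c}. C2 k \<subseteq> V2 m"
    and C1_card: "\<forall>k\<in>{1..c}. card (C1 k) \<ge> 2"
    and pairs: "\<forall>k\<in>{1..c}. \<forall>i\<in>C1 k. \<forall>j\<in>C1 k. i \<noteq> j \<longrightarrow>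
       card (exclusive_common m E {i, j} (V1 n - C1 k) \<inter> C2 k) = nC k"
    and C2_disjoint: "\<forall>i\<in>{1..c}. \<forall>j\<in>{1..c}. i \<noteq> j \<longrightarrow> C2 i \<inter> C2 j = {}"
  shows "\<forall>(\<theta>, x) \<in> feasible_set n m E.
     \<theta> \<le> (\<Sum>k=1..c. real (nC k) * (1 - (\<Sum>j\<in>C1 k. x j)))
        + (\<Sum>k\<in>D. real (private_count n m E k) * (1 - x k))
        + (\<Sum>j\<in>V1 n. real (cover m E {j}) * x j)"
proof (intro ballI case_prodI2)
  fix p \<theta> x
  assume p: "p \<in> feasible_set n m E" "p = (\<theta>, x)"
  define S where "S = {i \<in> V1 n. x i = 1}"
  have finV1: "finite (V1 n)" and finV2: "finite (V2 m)"
    by (simp_all add: V1_def V2_def)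
  have finS: "finite S" using finV1 by (simp add: S_def)
  have x01: "x i \<in> {0, 1}" if "i \<in> V1 n" for i
    using p that by (auto simp: feasible_set_def PiE_def Pi_def)
  have finC2: "finite (C2 k)" if "k \<in> {1..c}" for k
    using C2 that finV2 finite_subset by blast
  have sum_C1: "(\<Sum>j\<in>C1 k. x j) = real (card (S \<inter> C1 k))" if k: "k \<in> {1..c}" for k
  proof -
    have sub: "C1 k \<subseteq> V1 n" using C1 k by blast
    have "(\<Sum>j\<in>C1 k. 1 * x j) = (\<Sum>j\<in>{j \<in> C1 k. x j = 1}. 1)"
      using sub finV1 x01 by (intro sum_binary) (auto intro: finite_subset)
    moreover have "{j \<in> C1 k. x j = 1} = S \<inter> C1 k"
      using sub by (auto simp: S_def)
    ultimately show ?thesis by simp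
  qed
  have "(\<Sum>k=1..c. real (nC k) * ((\<Sum>j\<in>C1 k. x j) - 1))
      \<le> (\<Sum>k=1..c. real (\<Sum>v\<in>C2 k. excess E S v))"
  proof (rule sum_mono)
    fix k assume k: "k \<in> {1..c}"
    show "real (nC k) * ((\<Sum>j\<in>C1 k. x j) - 1) \<le> real (\<Sum>v\<in>C2 k. excess E S v)"
      unfolding sum_C1[OF k]
      by (rule clique_excess[OF finS finC2[OF k], where N = "V1 n - C1 k" and m = m])
        (use pairs k in blast)
  qed
  also have "\<dots> = real (\<Sum>v\<in>(\<Union>k\<in>{1..c}. C2 k). excess E S v)"
    using finC2 C2_disjoint by (subst sum.UNION_disjoint) auto
  also have "\<dots> \<le> real (\<Sum>v\<in>V2 m. excess E S v)"
    using C2 finV2 by (intro of_nat_mono sum_mono2) auto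
  finally have charged: "(\<Sum>k=1..c. real (nC k) * ((\<Sum>j\<in>C1 k. x j) - 1))
      \<le> real (\<Sum>v\<in>V2 m. excess E S v)" .
  have neg: "(\<Sum>k=1..c. real (nC k) * (1 - (\<Sum>j\<in>C1 k. x j)))
      = - (\<Sum>k=1..c. real (nC k) * ((\<Sum>j\<in>C1 k. x j) - 1))"
    by (simp only: sum_negf[symmetric] minus_mult_right minus_diff_eq)
  have "(\<Sum>j\<in>V1 n. real (cover m E {j}) * x j) = (\<Sum>j\<in>S. real (cover m E {j}))"
    unfolding S_def using finV1 x01 by (rule sum_binary)
  also have "\<dots> = real (\<Sum>j\<in>S. cover m E {j})" by simp
  also have "\<dots> = real (cover m E S) + real (\<Sum>v\<in>V2 m. excess E S v)"
    unfolding sum_cover_singletons[OF finS] by (rule of_nat_add)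
  finally have singles: "(\<Sum>j\<in>V1 n. real (cover m E {j}) * x j)
      = real (cover m E S) + real (\<Sum>v\<in>V2 m. excess E S v)" .
  have "x k \<le> 1" if "k \<in> D" for k
    using x01[OF subsetD[OF D that]] by auto
  then have "0 \<le> (\<Sum>k\<in>D. real (private_count n m E k) * (1 - x k))"
    by (intro sum_nonneg mult_nonneg_nonneg) auto
  moreover have "\<theta> \<le> real (cover m E S)"
    unfolding S_def using p by (intro feasible_le_cover_support) simp
  ultimately show "\<theta> \<le> (\<Sum>k=1..c. real (nC k) * (1 - (\<Sum>j\<in>C1 k. x j)))
      + (\<Sum>k\<in>D. real (private_count n m E k) * (1 - x k))
      + (\<Sum>j\<in>V1 n. real (cover m E {j}) * x j)"
    using charged neg singles by linarith
qed

end
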